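(* Let $G$ be a graph of order $n$ and size $m$ with $c$ components. Then there are at least $3^{m-n+c}$ and at most $4^{m-n+c}$ distinct mixed graphs up to switching equivalence on $G$; that is, $3^{m-n+c}\le|\Omega_{\mathcal{M}}(G)|\le 4^{m-n+c}$. Further, equality occurs in the upper bound if each fundamental cycle of $G$ with respect to a maximal forest $F$ of $G$ has at least two edges that do not lie on other fundamental cycles of $G$ with respect to $F$.
   Context: $G$ is a finite simple undirected graph; its order and size are its numbers of vertices and edges. A partial orientation $\phi$ of $G$ chooses a subset $S\subseteq E(G)$ and one of the two directions for each edge in $S$; the resulting mixed graph is $G^\phi$ (edges outside $S$ remain undirected). $\mathcal{M}(G)$ is the set of all mixed graphs $G^\phi$. The Hermitian adjacency matrix $H(G^\phi)=[h_{uv}]$ has $h_{uv}=1$ if $uv$ is an undirected edge, $h_{uv}=\mathbf{i}$ if the edge is directed from $u$ to $v$, $h_{uv}=-\mathbf{i}$ if it is directed from $v$ to $u$, and $h_{uv}=0$ otherwise, where $\mathbf{i}=\sqrt{-1}$. Mixed graphs $G^\phi,G^\gamma\in\mathcal{M}(G)$ are switching equivalent if $D^{-1}H(G^\phi)D=H(G^\gamma)$ for some diagonal matrix $D$ with diagonal entries in $\{1,-1,\mathbf{i},-\mathbf{i}\}$. This is an equivalence relation on $\mathcal{M}(G)$, and $\Omega_{\mathcal{M}}(G)$ denotes the set of its equivalence classes. A maximal forest $F$ of $G$ consists of a spanning tree of each component of $G$; for $e\in E(G)\setminus E(F)$ the fundamental cycle of $G$ with respect to $F$ and $e$ is the unique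 cycle in $F\cup\{e\}$. *)

theory Defs
  imports "HOL-Analysis.Analysis"
begin

section \<open>Simple graphs\<close>

text \<open>
  A finite simple undirected graph is given by its edge set; its vertex set is the whole of
  the finite type \<open>'v\<close>.  So its order is \<open>CARD('v)\<close> and its size is the
  cardinality of the edge set.
\<close>

definition simple_graph :: "'v::finite set set \<Rightarrow> bool" where
  "simple_graph E \<longleftrightarrow> (\<forall>e\<in>E. card e = 2)"

definition adjacency :: "'v set set \<Rightarrow> ('v \<times> 'v) set" where
  "adjacency E = {(u, v). {u, v} \<in> E}"

definition graph_components :: "'v::finite set set \<Rightarrow> 'v set set" where
  "graph_components E = UNIV // (adjacency E)\<^sup>*"

text \<open>A cycle is identified with its edge set.\<close>

definition closed_edges :: "'v list \<Rightarrow> 'v set set" where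
  "closed_edges vs = {{vs ! i, vs ! (Suc i mod length vs)} | i. i < length vs}"

definition cycle_in :: "'v set set \<Rightarrow> 'v set set \<Rightarrow> bool" where
  "cycle_in E C \<longleftrightarrow>
     C \<subseteq> E \<and> (\<exists>vs. 3 \<le> length vs \<and> distinct vs \<and> C = closed_edges vs)"

text \<open>\<open>tree_on W T\<close>: the graph with vertex set \<open>W\<close> and edge set \<open>T\<close> is a tree.\<close>

definition tree_on :: "'v set \<Rightarrow> 'v set set \<Rightarrow> bool" where
  "tree_on W T \<longleftrightarrow> W \<noteq> {} \<and> (\<forall>e\<in>T. e \<subseteq> W) \<and>
     (\<forall>u\<in>W. \<forall>v\<in>W. (u, v) \<in> (adjacency T)\<^sup>*) \<and> (\<nexists>C. cycle_in T C)"

definition maximal_forest :: "'v::finite set set \<Rightarrow> 'v set set \<Rightarrow> bool" where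
  "maximal_forest E F \<longleftrightarrow> F \<subseteq> E \<and> (\<forall>W\<in>graph_components E. tree_on W {e \<in> F. e \<subseteq> W})"

definition fundamental_cycle :: "'v set set \<Rightarrow> 'v set \<Rightarrow> 'v set set" where
  "fundamental_cycle F e = (THE C. cycle_in (insert e F) C)"

definition fundamental_cycles :: "'v set set \<Rightarrow> 'v set set \<Rightarrow> 'v set set set" where
  "fundamental_cycles E F = fundamental_cycle F ` (E - F)"


section \<open>Mixed graphs\<close>

text \<open>A mixed graph is a pair of its undirected edges and its arcs \<open>(u, v)\<close>,
  directed from \<open>u\<close> to \<open>v\<close>.\<close>

type_synonym 'v mixed_graph = "'v set set \<times> ('v \<times> 'v) set"

text \<open>A partial orientation is encoded by the set of its arcs; the set \<open>S\<close> of oriented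
  edges is \<open>underlying \<phi>\<close>.\<close>

definition underlying :: "('v \<times> 'v) set \<Rightarrow> 'v set set" where
  "underlying \<phi> = {{u, v} | u v. (u, v) \<in> \<phi>}"

definition partial_orientation :: "'v set set \<Rightarrow> ('v \<times> 'v) set \<Rightarrow> bool" where
  "partial_orientation E \<phi> \<longleftrightarrow>
     underlying \<phi> \<subseteq> E \<and> (\<forall>u v. (u, v) \<in> \<phi> \<longrightarrow> (v, u) \<notin> \<phi>)"

definition orient :: "'v set set \<Rightarrow> ('v \<times> 'v) set \<Rightarrow> 'v mixed_graph" where
  "orient E \<phi> = (E - underlying \<phi>, \<phi>)"

definition mixed_graphs :: "'v set set \<Rightarrow> 'v mixed_graph set" where
  "mixed_graphs E = {orient E \<phi> | \<phi>. partial_orientation E \<phi>}"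

definition hermitian_adjacency :: "'v::finite mixed_graph \<Rightarrow> complex ^ 'v ^ 'v" where
  "hermitian_adjacency X = (\<chi> u v.
     if {u, v} \<in> fst X then 1
     else if (u, v) \<in> snd X then \<i>
     else if (v, u) \<in> snd X then - \<i>
     else 0)"


section \<open>Switching equivalence\<close>

definition switching_matrix :: "complex ^ 'v ^ 'v \<Rightarrow> bool" where
  "switching_matrix D \<longleftrightarrow>
     (\<forall>u v. u \<noteq> v \<longrightarrow> D $ u $ v = 0) \<and> (\<forall>u. D $ u $ u \<in> {1, - 1, \<i>, - \<i>})"

definition switching_rel :: "'v::finite set set \<Rightarrow> ('v mixed_graph \<times> 'v mixed_graph) set" where
  "switching_rel E = {(X, Y) \<in> mixed_graphs E \<times> mixed_graphs E.
     \<exists>D. switching_matrix D \<and>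
         matrix_inv D ** hermitian_adjacency X ** D = hermitian_adjacency Y}"

definition switching_classes :: "'v::finite set set \<Rightarrow> 'v mixed_graph set set" where
  "switching_classes E = mixed_graphs E // switching_rel E"

end

theory Submission
  imports Defs
begin

text \<open>
  A mixed graph is read as a gain function: it puts the number \<open>h u v\<close> on each ordered
  adjacent pair, with \<open>h v u = inverse (h u v)\<close>, and switching replaces \<open>h u v\<close> by
  \<open>inverse (d u) * h u v * d v\<close>.  Along the edges of a spanning forest \<open>F\<close> the values of
  \<open>d\<close> can be chosen one after the other, so every gain can be switched to be \<open>1\<close> on
  \<open>F\<close>.  The remaining freedom is one constant on each component, and this cancels in every
  product \<open>inverse (d u) * h u v * d v\<close>.  Hence the values left on the chords
  \<open>e \<in> E - F\<close>, here called the residual of the gain, form a complete invariant of switching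
  (\<open>switching_iff_residual_eq\<close>), and the number of classes is the number of residuals of
  mixed graphs (\<open>card_switching_classes\<close>).  There are \<open>m - n + c\<close> chords
  (\<open>spanning_forest_card\<close>).
  
  A residual takes fourth roots of unity as values, which gives the upper bound.  Any function from the
  chords to \<open>{1, \<i>, -\<i>}\<close> is a residual, namely of the mixed graph that carries these values
  on the chords and leaves all edges of \<open>F\<close> undirected; this gives the lower bound.
  
  For equality in the upper bound, the value \<open>-1\<close> must be reached as well.  The gain that is
  \<open>1\<close> on \<open>F\<close> and has prescribed values on the chords has to be switched so that
  \<open>-1\<close> disappears.  An edge \<open>f \<in> F\<close> lies on the fundamental cycle of a chord exactly
  if its removal from \<open>F\<close> separates the ends of that chord (\<open>cycle_through_chord\<close>).  So
  a forest edge that is private to the fundamental cycle of \<open>e\<close> defines a cut which \<open>e\<close>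
  crosses and no other chord does.  Multiplying \<open>d\<close> by \<open>\<i>\<close> on one side of this cut
  turns the value \<open>-1\<close> on \<open>e\<close> into \<open>\<plusminus>\<i>\<close> and affects besides only the private edge,
  whose value becomes \<open>\<plusminus>\<i>\<close>.  As private edges of different chords are different, this can be
  done for all chords of value \<open>-1\<close> at once (\<open>card_classes_private_edges\<close>).
\<close>

section \<open>Reachability\<close>

lemma adjacency_mono: "A \<subseteq> B \<Longrightarrow> adjacency A \<subseteq> adjacency B"
  by (auto simp: adjacency_def)

lemma linked_mono: "A \<subseteq> B \<Longrightarrow> (x, y) \<in> (adjacency A)\<^sup>* \<Longrightarrow> (x, y) \<in> (adjacency B)\<^sup>*"
  using rtrancl_mono[OF adjacency_mono] by blast

lemma linked_sym: "(x, y) \<in> (adjacency A)\<^sup>* \<Longrightarrow> (y, x) \<in> (adjacency A)\<^sup>*"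
proof -
  have "sym (adjacency A)" by (auto simp: adjacency_def sym_def insert_commute)
  then show "(x, y) \<in> (adjacency A)\<^sup>* \<Longrightarrow> (y, x) \<in> (adjacency A)\<^sup>*"
    using sym_rtrancl symD by metis
qed

lemma linked_edge: "{x, y} \<in> A \<Longrightarrow> (x, y) \<in> (adjacency A)\<^sup>*"
  by (auto simp: adjacency_def)

lemma equiv_linked: "equiv UNIV ((adjacency A)\<^sup>*)"
  unfolding equiv_def
  by (auto simp: refl_rtrancl trans_rtrancl intro!: symI linked_sym)

lemma linked_insert:
  "(x, y) \<in> (adjacency (insert {u, v} F))\<^sup>* \<longleftrightarrow>
     (x, y) \<in> (adjacency F)\<^sup>* \<or>
     (x, u) \<in> (adjacency F)\<^sup>* \<and> (v, y) \<in> (adjacency F)\<^sup>* \<or>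
     (x, v) \<in> (adjacency F)\<^sup>* \<and> (u, y) \<in> (adjacency F)\<^sup>*"
proof -
  have eq: "adjacency (insert {u, v} F) = insert (u, v) (insert (v, u) (adjacency F))"
    by (auto simp: adjacency_def doubleton_eq_iff)
  show ?thesis
    unfolding eq rtrancl_insert by (auto intro: rtrancl_trans)
qed

lemma linked_absorb:
  assumes "(u, v) \<in> (adjacency F)\<^sup>*" and "(x, y) \<in> (adjacency (insert {u, v} F))\<^sup>*"
  shows "(x, y) \<in> (adjacency F)\<^sup>*"
  using assms linked_sym[OF assms(1)] unfolding linked_insert by (meson rtrancl_trans)

lemma constant_along_links:
  assumes "(x, y) \<in> (adjacency F)\<^sup>*" and "\<And>u v. {u, v} \<in> F \<Longrightarrow> q u = q v"
  shows "q x = q y"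
  using assms(1) by induction (auto simp: adjacency_def dest: assms(2))


section \<open>Cycles\<close>

lemma distinct_path_exists:
  assumes "(u, v) \<in> (adjacency F)\<^sup>*"
  shows "\<exists>vs. vs \<noteq> [] \<and> distinct vs \<and> hd vs = u \<and> last vs = v \<and>
              successively (\<lambda>x y. {x, y} \<in> F) vs"
  using assms
proof (induction rule: converse_rtrancl_induct)
  case base
  show ?case by (rule exI[of _ "[v]"]) auto
next
  case (step x y)
  then obtain vs where vs: "vs \<noteq> []" "distinct vs" "hd vs = y" "last vs = v"
    "successively (\<lambda>x y. {x, y} \<in> F) vs" by blast
  show ?case
  proof (cases "x \<in> set vs")
    case True
    then obtain as bs where "vs = as @ x # bs" by (meson split_list)
    with vs show ?thesis
      by (intro exI[of _ "x # bs"]) (auto simp: successively_append_iff)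
  next
    case False
    with vs step(1) show ?thesis
      by (intro exI[of _ "x # vs"]) (auto simp: adjacency_def successively_Cons)
  qed
qed

text \<open>
  Since the end points are not adjacent in \<open>F\<close>, a simple path between them has at least three
  vertices, so the closing edge turns it into a cycle.  This is the source of all cycles below.
\<close>

lemma cycle_closing_path:
  assumes "(u, v) \<in> (adjacency F)\<^sup>*" "u \<noteq> v" "{u, v} \<notin> F"
  shows "\<exists>C. cycle_in (insert {u, v} F) C"
proof -
  obtain vs where vs: "vs \<noteq> []" "distinct vs" "hd vs = u" "last vs = v"
    and path: "successively (\<lambda>x y. {x, y} \<in> F) vs"
    using distinct_path_exists[OF assms(1)] by blast
  have len: "3 \<le> length vs"
  proof (rule ccontr)
    assume "\<not> ?thesis"
    then have "length vs = 1 \<or> length vs = 2"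
      using vs(1) length_0_conv[of vs] by linarith
    then show False
      using vs assms(2,3) path by (auto simp: numeral_2_eq_2 length_Suc_conv)
  qed
  have "closed_edges vs \<subseteq> insert {u, v} F"
  proof
    fix f assume "f \<in> closed_edges vs"
    then obtain i where i: "i < length vs" "f = {vs ! i, vs ! (Suc i mod length vs)}"
      by (auto simp: closed_edges_def)
    show "f \<in> insert {u, v} F"
    proof (cases "Suc i < length vs")
      case True
      then show ?thesis using i path by (simp add: successively_conv_nth)
    next
      case False
      then have "Suc i = length vs" using i by simp
      then have "f = {last vs, hd vs}"
        using i vs(1) by (metis diff_Suc_1 hd_conv_nth last_conv_nth mod_self)
      then show ?thesis using vs by (simp add: insert_commute)
    qed
  qed
  then show ?thesis using len vs(2) unfolding cycle_in_def by blast
qed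

text \<open>
  With two vertices the closing edge would repeat the only edge of the path; from three vertices on,
  the position on the cycle determines the edge.
\<close>

lemma closed_edges_inj:
  assumes "distinct vs" "3 \<le> length vs" "i < length vs" "j < length vs"
    and "{vs ! i, vs ! (Suc i mod length vs)} = {vs ! j, vs ! (Suc j mod length vs)}"
  shows "i = j"
proof -
  have "Suc i mod length vs < length vs" "Suc j mod length vs < length vs"
    using assms(3) by (auto intro: mod_less_divisor)
  then show ?thesis
    using assms by (auto simp: doubleton_eq_iff nth_eq_iff_index_eq mod_Suc split: if_splits)
qed

text \<open>
  The rest of the cycle is a detour: from the head of the edge forward to the last vertex of the list,
  over the closing edge to the first one, and on to the tail of the edge.
\<close>

lemma cycle_edge_not_bridge:
  assumes "cycle_in A C" and "{a, b} \<in> C"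
  shows "(a, b) \<in> (adjacency (C - {{a, b}}))\<^sup>*"
proof -
  obtain vs where len: "3 \<le> length vs" and dist: "distinct vs" and C: "C = closed_edges vs"
    using assms(1) by (auto simp: cycle_in_def)
  let ?n = "length vs"
  obtain i where i: "i < ?n" and ab: "{a, b} = {vs ! i, vs ! (Suc i mod ?n)}"
    using assms(2) C by (auto simp: closed_edges_def)
  let ?R = "(adjacency (C - {{a, b}}))\<^sup>*"
  have edge: "(vs ! j, vs ! (Suc j mod ?n)) \<in> ?R" if "j < ?n" "j \<noteq> i" for j
  proof (rule linked_edge)
    have "{vs ! j, vs ! (Suc j mod ?n)} \<noteq> {a, b}"
      using closed_edges_inj[OF dist len that(1) i] that(2) ab by auto
    then show "{vs ! j, vs ! (Suc j mod ?n)} \<in> C - {{a, b}}"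
      using that(1) by (auto simp: C closed_edges_def)
  qed
  \<comment> \<open>Stretches of the list that do not run over the edge at position i.\<close>
  have segment: "(vs ! j, vs ! k) \<in> ?R" if "j \<le> k" "k < ?n" "i < j \<or> k \<le> i" for j k
    using that
  proof (induction k rule: dec_induct)
    case base
    show ?case by simp
  next
    case (step k)
    then have "(vs ! j, vs ! k) \<in> ?R" by (meson Suc_leD Suc_lessD)
    moreover have "(vs ! k, vs ! Suc k) \<in> ?R"
      using edge[of k] step by auto
    ultimately show ?case by (rule rtrancl_trans)
  qed
  have "(vs ! (Suc i mod ?n), vs ! i) \<in> ?R"
  proof (cases "Suc i = ?n")
    case True
    then show ?thesis using segment[of 0 i] i by simp
  next
    case False
    then have "(vs ! Suc i, vs ! (?n - 1)) \<in> ?R"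
      using segment[of "Suc i" "?n - 1"] i by simp
    moreover have "(vs ! (?n - 1), vs ! 0) \<in> ?R"
    proof -
      have "Suc (?n - 1) = ?n" using i by simp
      then show ?thesis using edge[of "?n - 1"] i False by (metis diff_Suc_1 lessI mod_self)
    qed
    moreover have "(vs ! 0, vs ! i) \<in> ?R"
      using segment[of 0 i] i by simp
    ultimately show ?thesis using False i by (auto intro: rtrancl_trans)
  qed
  moreover have "a = vs ! (Suc i mod ?n) \<and> b = vs ! i \<or> b = vs ! (Suc i mod ?n) \<and> a = vs ! i"
    using ab by (auto simp: doubleton_eq_iff)
  ultimately show ?thesis using linked_sym by metis
qed


section \<open>Spanning forests\<close>

text \<open>
  Equivalently, \<open>F\<close> contains no loop and no cycle.  Unlike the description by cycles, this form
  directly supports the induction that adds edges one by one.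
\<close>

definition all_bridges :: "'v set set \<Rightarrow> bool" where
  "all_bridges F \<longleftrightarrow> (\<forall>u v. {u, v} \<in> F \<longrightarrow> (u, v) \<notin> (adjacency (F - {{u, v}}))\<^sup>*)"

definition spanning_forest :: "'v set set \<Rightarrow> 'v set set \<Rightarrow> bool" where
  "spanning_forest E F \<longleftrightarrow>
     F \<subseteq> E \<and> (adjacency F)\<^sup>* = (adjacency E)\<^sup>* \<and> all_bridges F"

lemma all_bridges_subset:
  assumes "all_bridges F" "F' \<subseteq> F" shows "all_bridges F'"
  unfolding all_bridges_def
proof (intro allI impI)
  fix u v assume "{u, v} \<in> F'"
  then have "(u, v) \<notin> (adjacency (F - {{u, v}}))\<^sup>*"
    using assms by (auto simp: all_bridges_def)
  moreover have "F' - {{u, v}} \<subseteq> F - {{u, v}}" using assms(2) by blast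
  ultimately show "(u, v) \<notin> (adjacency (F' - {{u, v}}))\<^sup>*"
    using linked_mono by metis
qed

lemma simple_edgeE:
  assumes "simple_graph E" "e \<in> E"
  obtains u v where "e = {u, v}" "u \<noteq> v"
proof -
  have "card e = 2" using assms by (simp add: simple_graph_def)
  then show ?thesis using that by (auto simp: card_2_iff)
qed

text \<open>
  An edge is added while its ends are still in different components, because it is a bridge of the
  larger forest.
\<close>

lemma forest_induct [consumes 2, case_names empty insert]:
  fixes F :: "'v::finite set set"
  assumes "simple_graph F" and "all_bridges F" and "P {}"
    and step: "\<And>u v F. \<lbrakk>{u, v} \<notin> F; (u, v) \<notin> (adjacency F)\<^sup>*; P F\<rbrakk> \<Longrightarrow> P (insert {u, v} F)"
  shows "P F"
proof -
  have "finite F" by simp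
  then show ?thesis using assms(1,2)
  proof (induction F)
    case empty
    show ?case by (rule assms(3))
  next
    case (insert e F)
    obtain u v where e: "e = {u, v}" using insert.prems(1) by (auto elim: simple_edgeE)
    have "P F"
    proof (rule insert.IH)
      show "simple_graph F" using insert.prems(1) by (simp add: simple_graph_def)
      show "all_bridges F" using insert.prems(2) by (rule all_bridges_subset) auto
    qed
    moreover have "(u, v) \<notin> (adjacency F)\<^sup>*"
      using insert.prems(2) insert.hyps(2) e unfolding all_bridges_def by force
    ultimately show ?case using step insert.hyps(2) unfolding e by blast
  qed
qed

text \<open>
  The new edge merges the components \<open>?U\<close> and \<open>?V\<close> of its ends and leaves all others
  unchanged.
\<close>

lemma components_insert_bridge:
  fixes F :: "'v::finite set set"
  assumes "(u, v) \<notin> (adjacency F)\<^sup>*"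
  shows "card (graph_components F) = Suc (card (graph_components (insert {u, v} F)))"
proof -
  let ?R = "(adjacency F)\<^sup>*" and ?R' = "(adjacency (insert {u, v} F))\<^sup>*"
  let ?U = "?R `` {u}" and ?V = "?R `` {v}"
  note eqR = equiv_linked[of F]
  have s: "(y, x) \<in> ?R" if "(x, y) \<in> ?R" for x y using that by (rule linked_sym)
  have t: "(x, z) \<in> ?R" if "(x, y) \<in> ?R" "(y, z) \<in> ?R" for x y z using that by (rule rtrancl_trans)
  have UV: "?U \<noteq> ?V" using assms eqR by (simp add: eq_equiv_class_iff)
  have other: "?R' `` {x} = (if x \<in> ?U \<union> ?V then ?U \<union> ?V else ?R `` {x})" for x
  proof -
    have "(x, y) \<in> ?R' \<longleftrightarrow> (if (u, x) \<in> ?R \<or> (v, x) \<in> ?R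
            then (u, y) \<in> ?R \<or> (v, y) \<in> ?R else (x, y) \<in> ?R)" for y
      unfolding linked_insert using s t by meson
    then show ?thesis by (simp add: set_eq_iff)
  qed
  have fresh: "?U \<union> ?V \<notin> UNIV // ?R"
  proof
    assume "?U \<union> ?V \<in> UNIV // ?R"
    then obtain x where "?U \<union> ?V = ?R `` {x}" by (rule quotientE)
    moreover have "u \<in> ?U \<union> ?V" "v \<in> ?U \<union> ?V" by simp_all
    ultimately have "(x, u) \<in> ?R" "(x, v) \<in> ?R" by simp_all
    then show False using assms s t by meson
  qed
  have split: "x \<in> ?U \<union> ?V \<longleftrightarrow> ?R `` {x} = ?U \<or> ?R `` {x} = ?V" for x
    using s[of u x] s[of x u] s[of v x] s[of x v]
    by (auto simp: eq_equiv_class_iff[OF eqR])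
  have "UNIV // ?R' = insert (?U \<union> ?V) (UNIV // ?R - {?U, ?V})"
  proof (intro set_eqI iffI)
    fix W assume "W \<in> UNIV // ?R'"
    then obtain x where "W = ?R' `` {x}" by (auto elim: quotientE)
    then show "W \<in> insert (?U \<union> ?V) (UNIV // ?R - {?U, ?V})"
      using other[of x] split[of x] by (auto intro: quotientI split: if_splits)
  next
    fix W assume "W \<in> insert (?U \<union> ?V) (UNIV // ?R - {?U, ?V})"
    then consider "W = ?R' `` {u}" | x where "W = ?R `` {x}" "x \<notin> ?U \<union> ?V"
      using other[of u] split by (auto elim!: quotientE)
    then show "W \<in> UNIV // ?R'"
      using other by cases (metis UNIV_I quotientI)+
  qed
  moreover have "{?U, ?V} \<subseteq> UNIV // ?R" by (auto intro: quotientI)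
  ultimately have "card (UNIV // ?R') = Suc (card (UNIV // ?R) - 2)" "2 \<le> card (UNIV // ?R)"
    using fresh UV card_mono[of "UNIV // ?R" "{?U, ?V}"]
    by (simp_all add: card_Diff_subset)
  then show ?thesis unfolding graph_components_def by simp
qed

lemma card_forest:
  fixes F :: "'v::finite set set"
  assumes "simple_graph F" "all_bridges F"
  shows "card F + card (graph_components F) = CARD('v)"
  using assms
proof (induction rule: forest_induct)
  case empty
  have "graph_components ({} :: 'v set set) = range (\<lambda>x. {x})"
    by (auto simp: graph_components_def adjacency_def quotient_def)
  then show ?case by (simp add: card_image inj_on_def)
next
  case (insert u v F)
  then show ?case using components_insert_bridge[of u v F] by simp
qed

text \<open>
  Among the subgraphs with the same components as \<open>E\<close>, one with an inclusion-minimal edge set has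
  only bridges: any other edge could still be removed.
\<close>

lemma spanning_forest_exists:
  fixes E :: "'v::finite set set"
  shows "\<exists>F. spanning_forest E F"
proof -
  let ?S = "{F. F \<subseteq> E \<and> (adjacency F)\<^sup>* = (adjacency E)\<^sup>*}"
  obtain F where F: "F \<in> ?S" and min: "\<And>F'. F' \<in> ?S \<Longrightarrow> F' \<subseteq> F \<Longrightarrow> F = F'"
  proof -
    have "E \<in> ?S" by simp
    then have "?S \<noteq> {}" by blast
    then show ?thesis using that finite_has_minimal[of ?S] by (meson finite)
  qed
  have "all_bridges F"
    unfolding all_bridges_def
  proof (intro allI impI notI)
    fix u v assume uv: "{u, v} \<in> F" and link: "(u, v) \<in> (adjacency (F - {{u, v}}))\<^sup>*"
    have "(x, y) \<in> (adjacency (F - {{u, v}}))\<^sup>* \<longleftrightarrow> (x, y) \<in> (adjacency F)\<^sup>*" for x y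
      using linked_absorb[OF link, of x y] linked_mono[of "F - {{u, v}}" F x y] uv
      by (auto simp: insert_absorb)
    then have "(adjacency (F - {{u, v}}))\<^sup>* = (adjacency F)\<^sup>*" by auto
    then have "F - {{u, v}} \<in> ?S" using F by auto
    then show False using min uv by blast
  qed
  then show ?thesis using F unfolding spanning_forest_def by blast
qed

lemma spanning_forest_card:
  fixes E :: "'v::finite set set"
  assumes "simple_graph E" "spanning_forest E F"
  shows "int (card E) - int CARD('v) + int (card (graph_components E)) = int (card (E - F))"
proof -
  have FE: "F \<subseteq> E" using assms(2) by (simp add: spanning_forest_def)
  have "simple_graph F" using assms(1) FE by (auto simp: simple_graph_def)
  then have "card F + card (graph_components E) = CARD('v)"
    using card_forest[of F] assms(2) by (simp add: spanning_forest_def graph_components_def)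
  moreover have "card E = card F + card (E - F)"
    using FE by (metis card_Un_disjoint Diff_disjoint finite Diff_partition)
  ultimately show ?thesis by linarith
qed

text \<open>
  If an edge of \<open>F\<close> were not a bridge, a path around it would stay inside one component and close
  to a cycle in the tree that \<open>F\<close> induces there.
\<close>

lemma maximal_forest_spanning:
  fixes E :: "'v::finite set set"
  assumes simple: "simple_graph E" and max: "maximal_forest E F"
  shows "spanning_forest E F"
proof -
  have FE: "F \<subseteq> E" and trees: "\<And>W. W \<in> graph_components E \<Longrightarrow> tree_on W {e \<in> F. e \<subseteq> W}"
    using max by (auto simp: maximal_forest_def)
  have comp: "(adjacency E)\<^sup>* `` {u} \<in> graph_components E" for u
    by (auto simp: graph_components_def intro: quotientI)
  have "(u, v) \<in> (adjacency F)\<^sup>*" if "(u, v) \<in> (adjacency E)\<^sup>*" for u v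
  proof (rule linked_mono)
    let ?W = "(adjacency E)\<^sup>* `` {u}"
    show "(u, v) \<in> (adjacency {e \<in> F. e \<subseteq> ?W})\<^sup>*"
      using trees[OF comp[of u]] that unfolding tree_on_def by blast
  qed auto
  then have reach: "(adjacency F)\<^sup>* = (adjacency E)\<^sup>*"
    using linked_mono[OF FE] by auto
  have "all_bridges F"
    unfolding all_bridges_def
  proof (intro allI impI notI)
    fix u v assume uv: "{u, v} \<in> F" and link: "(u, v) \<in> (adjacency (F - {{u, v}}))\<^sup>*"
    let ?W = "(adjacency E)\<^sup>* `` {u}"
    let ?T = "{e \<in> F. e \<subseteq> ?W}"
    have "(u, x) \<in> (adjacency (?T - {{u, v}}))\<^sup>* \<and> x \<in> ?W"
      if "(u, x) \<in> (adjacency (F - {{u, v}}))\<^sup>*" for x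
      using that
    proof induction
      case base
      show ?case by simp
    next
      case (step y z)
      then have yz: "{y, z} \<in> F" "{y, z} \<noteq> {u, v}" by (auto simp: adjacency_def)
      then have "z \<in> ?W" using step.IH FE by (auto simp: adjacency_def intro: rtrancl.rtrancl_into_rtrancl)
      then have "(y, z) \<in> adjacency (?T - {{u, v}})"
        using yz step.IH by (auto simp: adjacency_def)
      then show ?case using step.IH \<open>z \<in> ?W\<close> by (auto intro: rtrancl.rtrancl_into_rtrancl)
    qed
    from this[OF link] have link': "(u, v) \<in> (adjacency (?T - {{u, v}}))\<^sup>*" and "v \<in> ?W"
      by auto
    then have "insert {u, v} (?T - {{u, v}}) = ?T" using uv by auto
    moreover have "u \<noteq> v" using simple_graph_def[of E] simple FE uv by (metis card_2_iff doubleton_eq_iff insert_absorb2 subsetD)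
    ultimately have "\<exists>C. cycle_in ?T C"
      using cycle_closing_path[OF link'] by auto
    then show False using trees[OF comp[of u]] by (auto simp: tree_on_def)
  qed
  then show ?thesis using FE reach by (simp add: spanning_forest_def)
qed


section \<open>Fundamental cycles\<close>

text \<open>
  For \<open>f\<close> on the cycle, a path in \<open>F - {f}\<close> between the ends of the chord could replace the
  chord in the rest of the cycle, and \<open>f\<close> would not be a bridge of \<open>F\<close>.  For \<open>f\<close>
  off the cycle, the cycle without its chord joins \<open>u\<close> and \<open>v\<close> in \<open>F - {f}\<close>.  The
  description does not mention \<open>C\<close>, so it proves that the fundamental cycle is unique, and it
  replaces cycles by cuts from here on.
\<close>

lemma cycle_through_chord:
  assumes bridges: "all_bridges F" and chord: "{u, v} \<notin> F"
    and cyc: "cycle_in (insert {u, v} F) C"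
  shows "C = insert {u, v} {f \<in> F. (u, v) \<notin> (adjacency (F - {f}))\<^sup>*}"
proof -
  have sub: "C \<subseteq> insert {u, v} F" using cyc by (simp add: cycle_in_def)
  obtain vs where "3 \<le> length vs" "C = closed_edges vs" using cyc by (auto simp: cycle_in_def)
  then have ne: "{vs ! 0, vs ! (1 mod length vs)} \<in> C"
    by (force simp: closed_edges_def)
  have uv: "{u, v} \<in> C"
  proof (rule ccontr)
    assume "{u, v} \<notin> C"
    then have "C \<subseteq> F" using sub by blast
    with ne show False
      using cycle_edge_not_bridge[OF cyc ne] bridges
        linked_mono[of "C - {{vs ! 0, vs ! (1 mod length vs)}}" "F - {{vs ! 0, vs ! (1 mod length vs)}}"]
      unfolding all_bridges_def by blast
  qed
  have "f \<in> C \<longleftrightarrow> (u, v) \<notin> (adjacency (F - {f}))\<^sup>*" if f: "f \<in> F" for f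
  proof
    assume fC: "f \<in> C"
    then obtain a b where ab: "f = {a, b}"
      using cyc by (auto simp: cycle_in_def closed_edges_def)
    show "(u, v) \<notin> (adjacency (F - {f}))\<^sup>*"
    proof (rule notI)
      assume link: "(u, v) \<in> (adjacency (F - {f}))\<^sup>*"
      have "C - {f} \<subseteq> insert {u, v} (F - {f})" using sub by blast
      moreover have "(a, b) \<in> (adjacency (C - {f}))\<^sup>*"
        using cycle_edge_not_bridge[OF cyc] fC unfolding ab .
      ultimately have "(a, b) \<in> (adjacency (insert {u, v} (F - {f})))\<^sup>*"
        by (rule linked_mono)
      then have "(a, b) \<in> (adjacency (F - {f}))\<^sup>*" by (rule linked_absorb[OF link])
      then show False using bridges f ab by (simp add: all_bridges_def)
    qed
  next
    assume nolink: "(u, v) \<notin> (adjacency (F - {f}))\<^sup>*"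
    show "f \<in> C"
    proof (rule ccontr)
      assume "f \<notin> C"
      then have "C - {{u, v}} \<subseteq> F - {f}" using sub by blast
      then show False
        using linked_mono[OF _ cycle_edge_not_bridge[OF cyc uv]] nolink by simp
    qed
  qed
  then show ?thesis using uv sub by blast
qed

lemma fundamental_cycle_eq:
  assumes "all_bridges F" "{u, v} \<notin> F" "u \<noteq> v" "(u, v) \<in> (adjacency F)\<^sup>*"
  shows "fundamental_cycle F {u, v} = insert {u, v} {f \<in> F. (u, v) \<notin> (adjacency (F - {f}))\<^sup>*}"
proof -
  obtain C where C: "cycle_in (insert {u, v} F) C"
    using cycle_closing_path[OF assms(4,3,2)] by (rule exE)
  have "fundamental_cycle F {u, v} = C"
    unfolding fundamental_cycle_def
  proof (rule the_equality[of _ C])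
    show "C' = C" if "cycle_in (insert {u, v} F) C'" for C'
      by (rule trans[OF cycle_through_chord[OF assms(1,2) that]
            cycle_through_chord[OF assms(1,2) C, symmetric]])
  qed (rule C)
  then show ?thesis using cycle_through_chord[OF assms(1,2) C] by (rule trans)
qed


section \<open>Gain functions and switching\<close>

definition fourth_roots :: "complex set" where
  "fourth_roots = {1, - 1, \<i>, - \<i>}"

definition mixed_values :: "complex set" where
  "mixed_values = {1, \<i>, - \<i>}"

lemma fourth_roots_closed:
  assumes "z \<in> fourth_roots"
  shows "z \<noteq> 0" "inverse z \<in> fourth_roots" "w \<in> fourth_roots \<Longrightarrow> z * w \<in> fourth_roots"
  using assms by (auto simp: fourth_roots_def)

lemma one_fourth_root: "1 \<in> fourth_roots"
  by (simp add: fourth_roots_def)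

lemma mixed_values_fourth_roots: "mixed_values \<subseteq> fourth_roots"
  by (auto simp: fourth_roots_def mixed_values_def)

lemma inverse_mixed_value: "z \<in> mixed_values \<Longrightarrow> inverse z \<in> mixed_values"
  by (auto simp: mixed_values_def)

text \<open>
  Only the values on adjacent pairs are constrained; gain functions that agree there are not
  distinguished below.
\<close>

definition gain_on :: "'v set set \<Rightarrow> ('v \<Rightarrow> 'v \<Rightarrow> complex) \<Rightarrow> bool" where
  "gain_on E g \<longleftrightarrow> (\<forall>u v. {u, v} \<in> E \<longrightarrow> g u v \<in> fourth_roots \<and> g v u = inverse (g u v))"

text \<open>
  The entry at \<open>(u, v)\<close> of \<open>D\<inverse> H D\<close>, where \<open>D\<close> is diagonal with entries \<open>d\<close>.
\<close>

definition switch :: "('v \<Rightarrow> complex) \<Rightarrow> ('v \<Rightarrow> 'v \<Rightarrow> complex) \<Rightarrow> 'v \<Rightarrow> 'v \<Rightarrow> complex" where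
  "switch d g u v = inverse (d u) * g u v * d v"

definition normalizes ::
  "'v set set \<Rightarrow> ('v \<Rightarrow> complex) \<Rightarrow> ('v \<Rightarrow> 'v \<Rightarrow> complex) \<Rightarrow> bool" where
  "normalizes F d g \<longleftrightarrow>
     range d \<subseteq> fourth_roots \<and> (\<forall>u v. {u, v} \<in> F \<longrightarrow> switch d g u v = 1)"

lemma switch_switch: "switch d' (switch d g) = switch (\<lambda>x. d x * d' x) g"
  by (simp add: switch_def fun_eq_iff)

lemma switch_reverse:
  "gain_on E g \<Longrightarrow> {u, v} \<in> E \<Longrightarrow> switch d g v u = inverse (switch d g u v)"
  by (simp add: switch_def gain_on_def)

lemma gain_on_switch:
  assumes "gain_on E g" "range d \<subseteq> fourth_roots"
  shows "gain_on E (switch d g)"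
proof -
  have "switch d g u v \<in> fourth_roots" if "{u, v} \<in> E" for u v
    using that assms unfolding switch_def gain_on_def by (intro fourth_roots_closed) auto
  then show ?thesis using switch_reverse[OF assms(1)] by (auto simp: gain_on_def)
qed

text \<open>
  When an edge \<open>{u, v}\<close> joins two components, multiplying \<open>d\<close> by a constant on the
  component of \<open>v\<close> corrects the value on this edge and changes no value inside a component.
\<close>

lemma normalizer_exists:
  fixes F :: "'v::finite set set"
  assumes "simple_graph F" "all_bridges F" "gain_on F g"
  shows "\<exists>d. normalizes F d g"
  using assms
proof (induction rule: forest_induct)
  case empty
  show ?case by (rule exI[of _ "\<lambda>_. 1"]) (auto simp: normalizes_def one_fourth_root)
next
  case (insert u v F)
  then obtain d where d: "normalizes F d g" by (auto simp: gain_on_def)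
  let ?R = "(adjacency F)\<^sup>*"
  \<comment> \<open>The factor that makes the value on the new edge 1.\<close>
  define z where "z = inverse (switch d g u v)"
  define d' where "d' x = (if (v, x) \<in> ?R then d x * z else d x)" for x
  have d_root: "d x \<in> fourth_roots" for x using d by (auto simp: normalizes_def)
  have g_root: "g u v \<in> fourth_roots" using insert.prems by (auto simp: gain_on_def)
  have z_root: "z \<in> fourth_roots"
    unfolding z_def switch_def by (intro fourth_roots_closed d_root g_root)
  have "range d' \<subseteq> fourth_roots"
    using d_root z_root by (auto simp: d'_def intro: fourth_roots_closed)
  moreover have "switch d' g u v = 1"
  proof -
    have "(v, u) \<notin> ?R" using insert.hyps(2) linked_sym by metis
    then have "switch d' g u v = switch d g u v * z" by (simp add: switch_def d'_def)
    then show ?thesis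
      using fourth_roots_closed(1)[OF z_root] unfolding z_def by simp
  qed
  moreover have "switch d' g x y = 1" if "{x, y} \<in> F" for x y
  proof -
    have "(v, x) \<in> ?R \<longleftrightarrow> (v, y) \<in> ?R"
      using linked_edge[OF that] linked_sym rtrancl_trans by metis
    then have "switch d' g x y = switch d g x y"
      using fourth_roots_closed(1)[OF z_root] by (simp add: switch_def d'_def)
    then show ?thesis using d that by (simp add: normalizes_def)
  qed
  ultimately have "normalizes (insert {u, v} F) d' g"
    using switch_reverse[OF insert.prems, of u v d'] by (auto simp: normalizes_def doubleton_eq_iff)
  then show ?case by blast
qed

text \<open>
  The quotient of two normalizers is constant along the edges of \<open>F\<close>, hence on the components
  of \<open>E\<close>, and cancels on every edge of \<open>E\<close>.
\<close>

lemma normalizer_unique: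
  assumes "spanning_forest E F" "gain_on E g" "normalizes F d g" "normalizes F d' g" "{u, v} \<in> E"
  shows "switch d g u v = switch d' g u v"
proof -
  have nz: "d x \<noteq> 0" "d' x \<noteq> 0" for x
    using assms(3,4) fourth_roots_closed(1) unfolding normalizes_def by blast+
  have "d u / d' u = d v / d' v"
  proof (rule constant_along_links[where q = "\<lambda>x. d x / d' x"])
    show "(u, v) \<in> (adjacency F)\<^sup>*"
      using assms(1,5) linked_edge by (auto simp: spanning_forest_def)
    fix x y assume xy: "{x, y} \<in> F"
    then have "g x y \<noteq> 0"
      using assms(1,2) fourth_roots_closed(1) unfolding spanning_forest_def gain_on_def by blast
    moreover have "switch d g x y = 1" "switch d' g x y = 1"
      using assms(3,4) xy by (auto simp: normalizes_def)
    ultimately have "d x = d y * g x y" "d' x = d' y * g x y"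
      using nz[of x] by (simp_all add: switch_def field_simps)
    then show "d x / d' x = d y / d' y"
      using \<open>g x y \<noteq> 0\<close> by simp
  qed
  then show ?thesis using nz[of u] nz[of v] by (simp add: switch_def field_simps)
qed


section \<open>Residual gains\<close>

text \<open>
  A gain has two mutually inverse values on an edge.  An arbitrary choice of a direction selects one of
  them, independently of the arcs of any mixed graph.
\<close>

definition tail :: "'v set \<Rightarrow> 'v" where
  "tail e = fst (SOME p. e = {fst p, snd p})"

definition head :: "'v set \<Rightarrow> 'v" where
  "head e = snd (SOME p. e = {fst p, snd p})"

lemma tail_head: "simple_graph E \<Longrightarrow> e \<in> E \<Longrightarrow> {tail e, head e} = e \<and> tail e \<noteq> head e"
proof -
  assume "simple_graph E" "e \<in> E"
  then obtain u v where e: "e = {u, v}" "u \<noteq> v" by (rule simple_edgeE)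
  have "e = {tail e, head e}"
    unfolding tail_def head_def by (rule someI[of _ "(u, v)"]) (simp add: e)
  then show ?thesis using e by auto
qed

text \<open>
  By \<open>normalizer_unique\<close> the value does not depend on the chosen normalizer.  It is the gain of
  the fundamental cycle of \<open>e\<close>, traversed along \<open>e\<close> from tail to head.
\<close>

definition residual ::
  "'v set set \<Rightarrow> 'v set set \<Rightarrow> ('v \<Rightarrow> 'v \<Rightarrow> complex) \<Rightarrow> 'v set \<Rightarrow> complex" where
  "residual E F g =
     (\<lambda>e\<in>E - F. switch (SOME d. normalizes F d g) g (tail e) (head e))"

lemma residual_eq:
  assumes "simple_graph E" "spanning_forest E F" "gain_on E g" "normalizes F d g"
  shows "residual E F g = (\<lambda>e\<in>E - F. switch d g (tail e) (head e))"
  unfolding residual_def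
proof (rule restrict_ext)
  fix e assume "e \<in> E - F"
  then have "{tail e, head e} \<in> E" using tail_head[OF assms(1)] by auto
  then show "switch (SOME d. normalizes F d g) g (tail e) (head e) = switch d g (tail e) (head e)"
    using normalizer_unique[OF assms(2,3) someI[of "\<lambda>d. normalizes F d g", OF assms(4)] assms(4)]
    by blast
qed

lemma spanning_normalizer_exists:
  fixes E :: "'v::finite set set"
  assumes "simple_graph E" "spanning_forest E F" "gain_on E g"
  shows "\<exists>d. normalizes F d g"
  using assms
  by (intro normalizer_exists) (auto simp: spanning_forest_def simple_graph_def gain_on_def)

lemma residual_in_PiE:
  fixes E :: "'v::finite set set"
  assumes "simple_graph E" "spanning_forest E F" "gain_on E g"
  shows "residual E F g \<in> (E - F) \<rightarrow>\<^sub>E fourth_roots"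
proof -
  obtain d where d: "normalizes F d g" using spanning_normalizer_exists[OF assms] by blast
  have "gain_on E (switch d g)"
    using d assms(3) by (intro gain_on_switch) (auto simp: normalizes_def)
  then show ?thesis
    unfolding residual_eq[OF assms d] gain_on_def using tail_head[OF assms(1)] by auto
qed

text \<open>
  If \<open>d\<close> switches \<open>g\<close> to \<open>g'\<close> and \<open>d'\<close> normalizes \<open>g'\<close>, then the product
  normalizes \<open>g\<close> with the same result.  Conversely, equal residuals mean that the normalized gains
  agree on all of \<open>E\<close>, so normalizing \<open>g\<close> and undoing the normalization of \<open>g'\<close>
  switches \<open>g\<close> to \<open>g'\<close>.
\<close>

lemma switching_iff_residual_eq:
  fixes E :: "'v::finite set set"
  assumes E: "simple_graph E" "spanning_forest E F" and g: "gain_on E g" and g': "gain_on E g'"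
  shows "(\<exists>d. range d \<subseteq> fourth_roots \<and> (\<forall>u v. {u, v} \<in> E \<longrightarrow> switch d g u v = g' u v)) \<longleftrightarrow>
         residual E F g = residual E F g'"
proof
  assume "\<exists>d. range d \<subseteq> fourth_roots \<and> (\<forall>u v. {u, v} \<in> E \<longrightarrow> switch d g u v = g' u v)"
  then obtain d where d: "range d \<subseteq> fourth_roots" "\<And>u v. {u, v} \<in> E \<Longrightarrow> switch d g u v = g' u v"
    by blast
  obtain d' where d': "normalizes F d' g'" using spanning_normalizer_exists[OF E g'] by blast
  let ?c = "\<lambda>x. d x * d' x"
  have agree: "switch ?c g u v = switch d' g' u v" if "{u, v} \<in> E" for u v
    using d(2)[OF that] unfolding switch_switch[symmetric] by (simp add: switch_def)
  have "range ?c \<subseteq> fourth_roots"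
    using d(1) d' by (auto simp: normalizes_def intro!: fourth_roots_closed)
  then have "normalizes F ?c g"
    using d' agree E(2) by (auto simp: normalizes_def spanning_forest_def)
  then show "residual E F g = residual E F g'"
    using residual_eq[OF E g] residual_eq[OF E g' d'] agree tail_head[OF E(1)]
    by (auto intro!: restrict_ext)
next
  assume eq: "residual E F g = residual E F g'"
  obtain d where d: "normalizes F d g" using spanning_normalizer_exists[OF E g] by blast
  obtain d' where d': "normalizes F d' g'" using spanning_normalizer_exists[OF E g'] by blast
  have agree: "switch d g u v = switch d' g' u v" if uv: "{u, v} \<in> E" for u v
  proof (cases "{u, v} \<in> F")
    case True
    then show ?thesis using d d' by (simp add: normalizes_def)
  next
    case False
    let ?e = "{u, v}"
    have e: "switch d g (tail ?e) (head ?e) = switch d' g' (tail ?e) (head ?e)"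
      using fun_cong[OF eq, of ?e] uv False
      unfolding residual_eq[OF E g d] residual_eq[OF E g' d'] by simp
    have "{tail ?e, head ?e} = {u, v}" using tail_head[OF E(1) uv] by simp
    then consider "tail ?e = u" "head ?e = v" | "tail ?e = v" "head ?e = u"
      by (auto simp: doubleton_eq_iff)
    then show ?thesis
    proof cases
      case 1
      then show ?thesis using e by simp
    next
      case 2
      then have "inverse (switch d g u v) = inverse (switch d' g' u v)"
        using e switch_reverse[OF g uv] switch_reverse[OF g' uv] by simp
      then show ?thesis by simp
    qed
  qed
  have root: "d x \<in> fourth_roots" "d' x \<in> fourth_roots" for x
    using d d' by (auto simp: normalizes_def)
  let ?c = "\<lambda>x. d x * inverse (d' x)"
  have "range ?c \<subseteq> fourth_roots" using root by (auto intro!: fourth_roots_closed)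
  moreover have "switch ?c g u v = g' u v" if "{u, v} \<in> E" for u v
    using agree[OF that] fourth_roots_closed(1)[OF root(1)] fourth_roots_closed(1)[OF root(2)]
    by (simp add: switch_def field_simps)
  ultimately show "\<exists>d. range d \<subseteq> fourth_roots \<and> (\<forall>u v. {u, v} \<in> E \<longrightarrow> switch d g u v = g' u v)"
    by blast
qed


section \<open>Mixed graphs as gain functions\<close>

definition entry :: "'v::finite mixed_graph \<Rightarrow> 'v \<Rightarrow> 'v \<Rightarrow> complex" where
  "entry X u v = hermitian_adjacency X $ u $ v"

lemma mixed_graph_entry:
  assumes "X \<in> mixed_graphs E"
  shows "{u, v} \<in> E \<Longrightarrow> entry X u v \<in> mixed_values"
    and "{u, v} \<in> E \<Longrightarrow> entry X v u = inverse (entry X u v)"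
    and "{u, v} \<notin> E \<Longrightarrow> entry X u v = 0"
proof -
  obtain \<phi> where X: "X = orient E \<phi>" and \<phi>: "partial_orientation E \<phi>"
    using assms by (auto simp: mixed_graphs_def)
  have arc: "{x, y} \<in> underlying \<phi> \<longleftrightarrow> (x, y) \<in> \<phi> \<or> (y, x) \<in> \<phi>" for x y
    by (auto simp: underlying_def doubleton_eq_iff)
  have arc_edge: "{x, y} \<in> E" "(y, x) \<notin> \<phi>" if "(x, y) \<in> \<phi>" for x y
    using that \<phi> arc[of x y] by (auto simp: partial_orientation_def)
  show "{u, v} \<in> E \<Longrightarrow> entry X u v \<in> mixed_values"
    using arc[of u v] by (auto simp: X orient_def entry_def hermitian_adjacency_def mixed_values_def)
  show "{u, v} \<in> E \<Longrightarrow> entry X v u = inverse (entry X u v)"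
    using arc[of u v] arc_edge(2)[of u v] arc_edge(2)[of v u]
    by (auto simp: X orient_def entry_def hermitian_adjacency_def insert_commute)
  show "{u, v} \<notin> E \<Longrightarrow> entry X u v = 0"
    using arc_edge(1)[of u v] arc_edge(1)[of v u]
    by (auto simp: X orient_def entry_def hermitian_adjacency_def insert_commute)
qed

lemma mixed_graph_gain: "X \<in> mixed_graphs E \<Longrightarrow> gain_on E (entry X)"
  using mixed_graph_entry mixed_values_fourth_roots unfolding gain_on_def by blast

text \<open>
  The arcs are the pairs of value \<open>\<i>\<close>; the value \<open>-\<i>\<close> then comes from the reversed pair.
\<close>

lemma gain_realized:
  assumes "simple_graph E" "gain_on E g" and mixed: "\<And>u v. {u, v} \<in> E \<Longrightarrow> g u v \<in> mixed_values"
  obtains X where "X \<in> mixed_graphs E" "\<And>u v. {u, v} \<in> E \<Longrightarrow> entry X u v = g u v"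
proof
  let ?\<phi> = "{(u, v). {u, v} \<in> E \<and> g u v = \<i>}"
  have flip: "g v u = inverse (g u v)" if "{u, v} \<in> E" for u v
    using that assms(2) by (simp add: gain_on_def)
  have "partial_orientation E ?\<phi>"
    using flip by (auto simp: partial_orientation_def underlying_def complex_eq_iff)
  then show "orient E ?\<phi> \<in> mixed_graphs E" by (auto simp: mixed_graphs_def)
  fix u v assume uv: "{u, v} \<in> E"
  have arc: "{u, v} \<in> underlying ?\<phi> \<longleftrightarrow> g u v = \<i> \<or> g v u = \<i>"
  proof -
    have "{v, u} \<in> E" using uv by (simp add: insert_commute)
    then show ?thesis using uv unfolding underlying_def by (auto simp: doubleton_eq_iff)
  qed
  show "entry (orient E ?\<phi>) u v = g u v"
    using mixed[OF uv] uv flip[OF uv] arc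
    by (auto simp: mixed_values_def entry_def orient_def hermitian_adjacency_def
        complex_eq_iff insert_commute)
qed

text \<open>
  \<open>matrix_inv\<close> is defined by choice, so it must first be identified with the diagonal matrix of the
  inverse entries.
\<close>

lemma diagonal_conjugation:
  fixes D H :: "complex ^ 'v ^ 'v::finite"
  assumes diag: "\<And>u v. u \<noteq> v \<Longrightarrow> D $ u $ v = 0" and nz: "\<And>u. D $ u $ u \<noteq> 0"
  shows "(matrix_inv D ** H ** D) $ u $ v = inverse (D $ u $ u) * H $ u $ v * D $ v $ v"
proof -
  define B :: "complex ^ 'v ^ 'v" where
    "B = (\<chi> i j. if i = j then inverse (D $ i $ i) else 0)"
  have mult_D: "(M ** D) $ i $ j = M $ i $ j * D $ j $ j" for M :: "complex ^ 'v ^ 'v" and i j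
  proof -
    have "(\<Sum>k\<in>UNIV. M $ i $ k * D $ k $ j) = (\<Sum>k\<in>UNIV. if k = j then M $ i $ k * D $ k $ j else 0)"
      using diag by (intro sum.cong) auto
    then show ?thesis by (simp add: matrix_matrix_mult_def)
  qed
  have mult_B: "(B ** M) $ i $ j = inverse (D $ i $ i) * M $ i $ j"
    for M :: "complex ^ 'v ^ 'v" and i j
    by (simp add: matrix_matrix_mult_def B_def if_distrib[of "\<lambda>x. x * _"] cong: if_cong)
  have BD: "B ** D = mat 1"
    using nz by (auto simp: vec_eq_iff mult_D B_def mat_def)
  moreover from BD have "D ** B = mat 1" by (simp add: matrix_left_right_inverse)
  ultimately have "D ** matrix_inv D = mat 1"
    unfolding matrix_inv_def by (metis (mono_tags, lifting) someI_ex)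
  then have "matrix_inv D = B"
    by (metis BD matrix_mul_assoc matrix_mul_lid matrix_mul_rid)
  then show ?thesis by (simp add: mult_D mult_B)
qed

lemma switching_rel_iff:
  fixes E :: "'v::finite set set"
  assumes X: "X \<in> mixed_graphs E" and Y: "Y \<in> mixed_graphs E"
  shows "(X, Y) \<in> switching_rel E \<longleftrightarrow>
     (\<exists>d. range d \<subseteq> fourth_roots \<and>
          (\<forall>u v. {u, v} \<in> E \<longrightarrow> switch d (entry X) u v = entry Y u v))"
proof -
  have conj: "matrix_inv D ** hermitian_adjacency X ** D = hermitian_adjacency Y \<longleftrightarrow>
      (\<forall>u v. {u, v} \<in> E \<longrightarrow> switch (\<lambda>x. D $ x $ x) (entry X) u v = entry Y u v)"
    if D: "switching_matrix D" for D
  proof -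
    have "D $ u $ u \<noteq> 0" for u
      using D fourth_roots_closed(1) unfolding switching_matrix_def fourth_roots_def by blast
    then have "(matrix_inv D ** hermitian_adjacency X ** D) $ u $ v =
        switch (\<lambda>x. D $ x $ x) (entry X) u v" for u v
      using D by (subst diagonal_conjugation) (auto simp: switching_matrix_def switch_def entry_def)
    then have "matrix_inv D ** hermitian_adjacency X ** D = hermitian_adjacency Y \<longleftrightarrow>
        (\<forall>u v. switch (\<lambda>x. D $ x $ x) (entry X) u v = entry Y u v)"
      by (simp add: vec_eq_iff entry_def)
    moreover have "switch (\<lambda>x. D $ x $ x) (entry X) u v = entry Y u v" if "{u, v} \<notin> E" for u v
      using mixed_graph_entry(3)[OF X that] mixed_graph_entry(3)[OF Y that]
      by (simp add: switch_def)
    ultimately show ?thesis by auto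
  qed
  show ?thesis
  proof
    assume "(X, Y) \<in> switching_rel E"
    then obtain D where D: "switching_matrix D"
      "matrix_inv D ** hermitian_adjacency X ** D = hermitian_adjacency Y"
      by (auto simp: switching_rel_def)
    then have "range (\<lambda>x. D $ x $ x) \<subseteq> fourth_roots"
      unfolding switching_matrix_def fourth_roots_def by blast
    then show "\<exists>d. range d \<subseteq> fourth_roots \<and>
        (\<forall>u v. {u, v} \<in> E \<longrightarrow> switch d (entry X) u v = entry Y u v)"
      using conj[OF D(1)] D(2) by blast
  next
    assume "\<exists>d. range d \<subseteq> fourth_roots \<and>
        (\<forall>u v. {u, v} \<in> E \<longrightarrow> switch d (entry X) u v = entry Y u v)"
    then obtain d where d: "range d \<subseteq> fourth_roots"
      "\<forall>u v. {u, v} \<in> E \<longrightarrow> switch d (entry X) u v = entry Y u v" by blast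
    let ?D = "(\<chi> i j. if i = j then d i else 0) :: complex ^ 'v ^ 'v"
    have "switching_matrix ?D"
      using d(1) unfolding switching_matrix_def fourth_roots_def by auto
    then show "(X, Y) \<in> switching_rel E"
      using conj[of ?D] d(2) X Y unfolding switching_rel_def by auto
  qed
qed


section \<open>Counting switching classes\<close>

lemma card_quotient_kernel:
  "card (A // {(x, y) \<in> A \<times> A. f x = f y}) = card (f ` A)"
proof -
  let ?R = "{(x, y) \<in> A \<times> A. f x = f y}"
  have "?R `` {x} = {y \<in> A. f y = f x}" if "x \<in> A" for x
    using that by auto
  then have "A // ?R = (\<lambda>z. {y \<in> A. f y = z}) ` f ` A"
    by (auto simp: quotient_def)
  moreover have "inj_on (\<lambda>z. {y \<in> A. f y = z}) (f ` A)"
    by (rule inj_onI) blast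
  ultimately show ?thesis by (simp add: card_image)
qed

lemma card_switching_classes:
  fixes E :: "'v::finite set set"
  assumes "simple_graph E" "spanning_forest E F"
  shows "card (switching_classes E) = card ((\<lambda>X. residual E F (entry X)) ` mixed_graphs E)"
proof -
  have "(X, Y) \<in> switching_rel E \<longleftrightarrow>
      X \<in> mixed_graphs E \<and> Y \<in> mixed_graphs E \<and> residual E F (entry X) = residual E F (entry Y)"
    for X Y
  proof (cases "X \<in> mixed_graphs E \<and> Y \<in> mixed_graphs E")
    case True
    then show ?thesis
      using switching_rel_iff switching_iff_residual_eq[OF assms] mixed_graph_gain by metis
  next
    case False
    then show ?thesis by (auto simp: switching_rel_def)
  qed
  then have "switching_rel E = {(X, Y) \<in> mixed_graphs E \<times> mixed_graphs E.
      residual E F (entry X) = residual E F (entry Y)}" by auto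
  then show ?thesis unfolding switching_classes_def by (simp only: card_quotient_kernel)
qed

text \<open>
  The gain that is normalized on \<open>F\<close> and whose residual is \<open>t\<close>.  It may take the value
  \<open>-1\<close>, and then it is not the gain of a mixed graph.
\<close>

definition cotree_gain :: "'v set set \<Rightarrow> ('v set \<Rightarrow> complex) \<Rightarrow> 'v \<Rightarrow> 'v \<Rightarrow> complex" where
  "cotree_gain F t u v =
     (if {u, v} \<in> F then 1
      else if u = tail {u, v} then t {u, v} else inverse (t {u, v}))"

text \<open>
  The hypotheses \<open>tree\<close> and \<open>cotree\<close> say that switching the normalized gain by \<open>d\<close>
  yields the gain of a mixed graph.  Its residual is \<open>t\<close>, because the inverse of \<open>d\<close>
  switches it back.
\<close>

lemma residual_realized:
  fixes E :: "'v::finite set set"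
  assumes E: "simple_graph E" "spanning_forest E F"
    and t: "t \<in> (E - F) \<rightarrow>\<^sub>E fourth_roots"
    and d: "range d \<subseteq> fourth_roots"
    and tree: "\<And>u v. {u, v} \<in> F \<Longrightarrow> inverse (d u) * d v \<in> mixed_values"
    and cotree: "\<And>e. e \<in> E - F \<Longrightarrow> inverse (d (tail e)) * t e * d (head e) \<in> mixed_values"
  shows "t \<in> (\<lambda>X. residual E F (entry X)) ` mixed_graphs E"
proof -
  let ?h = "cotree_gain F t"
  have FE: "F \<subseteq> E" using E(2) by (simp add: spanning_forest_def)
  have t_root: "t e \<in> fourth_roots" if "e \<in> E - F" for e using t that by auto
  have orientation: "u = tail {u, v} \<and> v = head {u, v} \<or> u = head {u, v} \<and> v = tail {u, v}"
    if "{u, v} \<in> E" for u v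
    using tail_head[OF E(1) that] by (auto simp: doubleton_eq_iff)
  have h: "gain_on E ?h"
    unfolding gain_on_def
  proof (intro allI impI conjI)
    fix u v assume uv: "{u, v} \<in> E"
    show "?h u v \<in> fourth_roots"
      using t_root[of "{u, v}"] uv fourth_roots_closed(2)
      by (auto simp: cotree_gain_def one_fourth_root)
    show "?h v u = inverse (?h u v)"
      using orientation[OF uv] tail_head[OF E(1) uv]
      by (auto simp: cotree_gain_def insert_commute)
  qed
  have "switch d ?h u v \<in> mixed_values" if uv: "{u, v} \<in> E" for u v
  proof (cases "{u, v} \<in> F")
    case True
    then show ?thesis using tree by (simp add: switch_def cotree_gain_def)
  next
    case False
    let ?e = "{u, v}"
    have th: "{tail ?e, head ?e} = ?e" using tail_head[OF E(1) uv] by simp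
    have "switch d ?h (tail ?e) (head ?e) \<in> mixed_values"
      using cotree[of ?e] uv False by (simp add: switch_def cotree_gain_def th)
    moreover from this have "switch d ?h (head ?e) (tail ?e) \<in> mixed_values"
      using switch_reverse[OF h, of "tail ?e" "head ?e" d] th uv inverse_mixed_value by simp
    ultimately show ?thesis using orientation[OF uv] by metis
  qed
  then obtain X where X: "X \<in> mixed_graphs E" and
    X_entry: "\<And>u v. {u, v} \<in> E \<Longrightarrow> entry X u v = switch d ?h u v"
    using gain_realized[OF E(1) gain_on_switch[OF h d]] by blast
  let ?d = "\<lambda>x. inverse (d x)"
  have nz: "d x \<noteq> 0" for x using d fourth_roots_closed(1) by blast
  have undo: "switch ?d (entry X) u v = ?h u v" if "{u, v} \<in> E" for u v
    using X_entry[OF that] nz by (simp add: switch_def)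
  have "range ?d \<subseteq> fourth_roots" using d by (auto intro: fourth_roots_closed)
  then have "normalizes F ?d (entry X)"
    using undo FE by (auto simp: normalizes_def cotree_gain_def)
  then have "residual E F (entry X) = (\<lambda>e\<in>E - F. ?h (tail e) (head e))"
    using residual_eq[OF E mixed_graph_gain[OF X]] undo tail_head[OF E(1)]
    by (auto intro!: restrict_ext)
  also have "\<dots> = (\<lambda>e\<in>E - F. t e)"
    using tail_head[OF E(1)] by (intro restrict_ext) (simp add: cotree_gain_def)
  also have "\<dots> = t" using t by (simp add: PiE_restrict)
  finally show ?thesis using X by auto
qed

lemma card_fourth_roots: "card fourth_roots = 4"
  by (simp add: fourth_roots_def complex_eq_iff)

lemma card_mixed_values: "card mixed_values = 3"
  by (simp add: mixed_values_def complex_eq_iff)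

lemma card_classes_lower:
  fixes E :: "'v::finite set set"
  assumes E: "simple_graph E" "spanning_forest E F"
  shows "3 ^ card (E - F) \<le> card (switching_classes E)"
proof -
  have "(E - F) \<rightarrow>\<^sub>E mixed_values \<subseteq> (\<lambda>X. residual E F (entry X)) ` mixed_graphs E"
  proof
    fix t assume t: "t \<in> (E - F) \<rightarrow>\<^sub>E mixed_values"
    show "t \<in> (\<lambda>X. residual E F (entry X)) ` mixed_graphs E"
    proof (rule residual_realized[OF E, where d = "\<lambda>_. 1"])
      show "t \<in> (E - F) \<rightarrow>\<^sub>E fourth_roots" using t mixed_values_fourth_roots by blast
    qed (use t in \<open>auto simp: one_fourth_root mixed_values_def\<close>)
  qed
  from card_mono[OF _ this] show ?thesis
    by (simp add: card_switching_classes[OF E] card_PiE card_mixed_values)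
qed

lemma card_classes_upper:
  fixes E :: "'v::finite set set"
  assumes E: "simple_graph E" "spanning_forest E F"
  shows "card (switching_classes E) \<le> 4 ^ card (E - F)"
proof -
  have "(\<lambda>X. residual E F (entry X)) ` mixed_graphs E \<subseteq> (E - F) \<rightarrow>\<^sub>E fourth_roots"
    using residual_in_PiE[OF E] mixed_graph_gain by blast
  moreover have "finite ((E - F) \<rightarrow>\<^sub>E fourth_roots)"
    by (intro finite_PiE) (auto simp: fourth_roots_def)
  ultimately have "card ((\<lambda>X. residual E F (entry X)) ` mixed_graphs E)
      \<le> card ((E - F) \<rightarrow>\<^sub>E fourth_roots)"
    by (intro card_mono)
  then show ?thesis
    by (simp add: card_switching_classes[OF E] card_PiE card_fourth_roots)
qed

lemma prod_single_factor:
  assumes "finite B" "\<And>e. e \<in> B \<Longrightarrow> e \<noteq> e0 \<Longrightarrow> h e = 1"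
  shows "prod h B = (if e0 \<in> B then h e0 else 1)"
proof -
  have "prod h B = (\<Prod>e\<in>B. if e = e0 then h e else 1)"
    using assms(2) by (intro prod.cong) auto
  then show ?thesis using assms(1) by (simp add: prod.delta')
qed

definition separates :: "'v set set \<Rightarrow> 'v set \<Rightarrow> 'v set \<Rightarrow> bool" where
  "separates F f e \<longleftrightarrow> (tail e, head e) \<notin> (adjacency (F - {f}))\<^sup>*"

text \<open>
  The cut of \<open>F - {f e}\<close> is crossed by the chord \<open>e\<close> and by \<open>f e\<close>, and by no other chord
  or forest edge.  Multiplying \<open>d\<close> by \<open>\<i>\<close> on one side of it therefore repairs a
  prescribed value \<open>-1\<close> on \<open>e\<close> at the cost of giving \<open>f e\<close> the value
  \<open>\<i>\<close> or \<open>-\<i>\<close>.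
\<close>

lemma card_classes_private_edges:
  fixes E :: "'v::finite set set"
  assumes E: "simple_graph E" "spanning_forest E F"
    and f: "\<And>e. e \<in> E - F \<Longrightarrow> f e \<in> F"
    and sep: "\<And>e e'. e \<in> E - F \<Longrightarrow> e' \<in> E - F \<Longrightarrow> separates F (f e) e' \<longleftrightarrow> e' = e"
  shows "card (switching_classes E) = 4 ^ card (E - F)"
proof (rule antisym[OF card_classes_upper[OF E]])
  have "(E - F) \<rightarrow>\<^sub>E fourth_roots \<subseteq> (\<lambda>X. residual E F (entry X)) ` mixed_graphs E"
  proof
    fix t assume t: "t \<in> (E - F) \<rightarrow>\<^sub>E fourth_roots"
    define B where "B = {e \<in> E - F. t e = - 1}"
    \<comment> \<open>The factor that the cut of f e contributes to d: the component of tail e in F without f e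
      is multiplied by \<i>, and all other vertices by 1.\<close>
    define s where "s e x = (if (tail e, x) \<in> (adjacency (F - {f e}))\<^sup>* then \<i> else 1)" for e x
    define d where "d x = (\<Prod>e\<in>B. s e x)" for x
    have fin: "finite B" by simp
    have quotient: "inverse (d x) * d y = (\<Prod>e\<in>B. inverse (s e x) * s e y)" for x y
      by (simp add: d_def prod.distrib prod_inversef[symmetric])
    have s_linked: "s e x = s e y" if "(x, y) \<in> (adjacency (F - {f e}))\<^sup>*" for e x y
      using that linked_sym[OF that] rtrancl_trans unfolding s_def by metis
    have cut: "inverse (s e x) * s e y \<in> mixed_values" for e x y
      by (auto simp: s_def mixed_values_def)
    \<comment> \<open>The sign follows from the side that carries the factor \<i>: the tail of e does, its head does not.\<close>
    have across: "inverse (s e (tail e)) * s e (head e) = - \<i>" if "e \<in> E - F" for e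
      using sep[OF that that] by (simp add: s_def separates_def)
    show "t \<in> (\<lambda>X. residual E F (entry X)) ` mixed_graphs E"
    proof (rule residual_realized[OF E t])
      have "d x \<in> fourth_roots" for x
        unfolding d_def using fin
        by (induction B) (auto simp: s_def one_fourth_root intro!: fourth_roots_closed,
            auto simp: fourth_roots_def)
      then show "range d \<subseteq> fourth_roots" by blast
    next
      fix x y assume xy: "{x, y} \<in> F"
      show "inverse (d x) * d y \<in> mixed_values"
      proof (cases "\<exists>e0\<in>B. f e0 = {x, y}")
        case True
        then obtain e0 where e0: "e0 \<in> B" "f e0 = {x, y}" by blast
        have "inverse (s e x) * s e y = 1" if "e \<in> B" "e \<noteq> e0" for e
        proof -
          \<comment> \<open>Equal private edges would give equal cuts, crossed by both e and e0.\<close>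
          have "f e \<noteq> f e0"
            using sep[of e e] sep[of e0 e] that e0(1) by (auto simp: B_def)
          then have "s e x = s e y" using e0(2) xy by (intro s_linked linked_edge) auto
          then show ?thesis by (simp add: s_def)
        qed
        then have "inverse (d x) * d y = inverse (s e0 x) * s e0 y"
          using prod_single_factor[OF fin, of e0 "\<lambda>e. inverse (s e x) * s e y"] e0(1)
          unfolding quotient by simp
        then show ?thesis using cut by simp
      next
        case False
        have "inverse (s e x) * s e y = 1" if "e \<in> B" for e
        proof -
          have "s e x = s e y" using that False xy by (intro s_linked linked_edge) auto
          then show ?thesis by (simp add: s_def)
        qed
        then show ?thesis unfolding quotient by (simp add: mixed_values_def)
      qed
    next
      fix e assume e: "e \<in> E - F"
      have "inverse (s e' (tail e)) * s e' (head e) = 1" if "e' \<in> B" "e' \<noteq> e" for e'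
      proof -
        have "s e' (tail e) = s e' (head e)"
          using sep[of e' e] that e by (intro s_linked) (auto simp: B_def separates_def)
        then show ?thesis by (simp add: s_def)
      qed
      then have "inverse (d (tail e)) * d (head e) = (if e \<in> B then - \<i> else 1)"
        unfolding quotient
        using prod_single_factor[OF fin, of e "\<lambda>e'. inverse (s e' (tail e)) * s e' (head e)"]
          across[OF e] by simp
      then have "inverse (d (tail e)) * t e * d (head e) = t e * (if e \<in> B then - \<i> else 1)"
        by (simp add: mult_ac)
      moreover have "t e \<in> fourth_roots" using t e by auto
      moreover have "\<i> \<noteq> - 1" by (simp add: complex_eq_iff)
      ultimately show "inverse (d (tail e)) * t e * d (head e) \<in> mixed_values"
        using e by (auto simp: B_def fourth_roots_def mixed_values_def)
    qed
  qed
  from card_mono[OF _ this] show "4 ^ card (E - F) \<le> card (switching_classes E)"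
    by (simp add: card_switching_classes[OF E] card_PiE card_fourth_roots)
qed

text \<open>
  The chord \<open>e\<close> itself is always private to its fundamental cycle.  This is why two private edges
  are required: the second one lies in \<open>F\<close>.
\<close>

lemma private_forest_edge:
  fixes E :: "'v::finite set set"
  assumes E: "simple_graph E" "spanning_forest E F"
    and two: "\<forall>C \<in> fundamental_cycles E F.
                2 \<le> card {f \<in> C. \<forall>C' \<in> fundamental_cycles E F. C' \<noteq> C \<longrightarrow> f \<notin> C'}"
    and e: "e \<in> E - F"
  shows "\<exists>f\<in>F. \<forall>e'\<in>E - F. separates F f e' \<longleftrightarrow> e' = e"
proof -
  have fundamental: "fundamental_cycle F e' = insert e' {f \<in> F. separates F f e'}"
    if "e' \<in> E - F" for e'
  proof -
    have th: "{tail e', head e'} = e'" "tail e' \<noteq> head e'"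
      using tail_head[OF E(1)] that by auto
    have "(tail e', head e') \<in> (adjacency F)\<^sup>*"
      using E(2) linked_edge[of "tail e'" "head e'" E] that th(1) by (simp add: spanning_forest_def)
    then show ?thesis
      using fundamental_cycle_eq[of F "tail e'" "head e'"] E(2) that th
      by (simp add: spanning_forest_def separates_def)
  qed
  let ?C = "fundamental_cycle F e"
  let ?P = "{f \<in> ?C. \<forall>C' \<in> fundamental_cycles E F. C' \<noteq> ?C \<longrightarrow> f \<notin> C'}"
  have "2 \<le> card ?P" using two e by (auto simp: fundamental_cycles_def)
  then have "\<not> ?P \<subseteq> {e}" using card_mono[of "{e}" ?P] by auto
  then obtain f where f: "f \<in> ?P" "f \<noteq> e" by blast
  then have fF: "f \<in> F" "separates F f e" using fundamental[OF e] by auto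
  have "\<not> separates F f e'" if e': "e' \<in> E - F" "e' \<noteq> e" for e'
  proof -
    have "e \<in> ?C" "e \<notin> fundamental_cycle F e'"
      using fundamental[OF e] fundamental[OF e'(1)] e e' by auto
    then have "f \<notin> fundamental_cycle F e'"
      using f(1) e'(1) by (auto simp: fundamental_cycles_def)
    then show ?thesis using fundamental[OF e'(1)] fF(1) by blast
  qed
  then show ?thesis using fF by blast
qed

theorem theorem3p3:
  fixes E :: "'v::finite set set" and n m c :: nat
  assumes "simple_graph E"
    and "n = CARD('v)" and "m = card E" and "c = card (graph_components E)"
  shows "(3::real) powi (int m - int n + int c) \<le> real (card (switching_classes E)) \<and>
         real (card (switching_classes E)) \<le> 4 powi (int m - int n + int c) \<and>
         (\<forall>F. maximal_forest E F \<and>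
              (\<forall>C \<in> fundamental_cycles E F.
                 2 \<le> card {e \<in> C. \<forall>C' \<in> fundamental_cycles E F. C' \<noteq> C \<longrightarrow> e \<notin> C'}) \<longrightarrow>
              real (card (switching_classes E)) = 4 powi (int m - int n + int c))"
proof (intro conjI allI impI)
  have rank: "int m - int n + int c = int (card (E - F))" if "spanning_forest E F" for F
    using spanning_forest_card[OF assms(1) that] assms(2-4) by simp
  obtain F where F: "spanning_forest E F" using spanning_forest_exists by blast
  show "(3::real) powi (int m - int n + int c) \<le> real (card (switching_classes E))"
    using card_classes_lower[OF assms(1) F] unfolding rank[OF F] power_int_of_nat
    by (metis of_nat_le_iff of_nat_numeral of_nat_power)
  show "real (card (switching_classes E)) \<le> 4 powi (int m - int n + int c)"
    using card_classes_upper[OF assms(1) F] unfolding rank[OF F] power_int_of_nat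
    by (metis of_nat_le_iff of_nat_numeral of_nat_power)
next
  fix F assume asm: "maximal_forest E F \<and>
      (\<forall>C \<in> fundamental_cycles E F.
         2 \<le> card {e \<in> C. \<forall>C' \<in> fundamental_cycles E F. C' \<noteq> C \<longrightarrow> e \<notin> C'})"
  then have F: "spanning_forest E F" by (intro maximal_forest_spanning assms(1)) simp
  have rank: "int m - int n + int c = int (card (E - F))"
    using spanning_forest_card[OF assms(1) F] assms(2-4) by simp
  have "\<forall>e\<in>E - F. \<exists>f\<in>F. \<forall>e'\<in>E - F. separates F f e' \<longleftrightarrow> e' = e"
    using private_forest_edge[OF assms(1) F] asm by blast
  then obtain f where "\<And>e. e \<in> E - F \<Longrightarrow> f e \<in> F"
    "\<And>e e'. e \<in> E - F \<Longrightarrow> e' \<in> E - F \<Longrightarrow> separates F (f e) e' \<longleftrightarrow> e' = e"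
    by metis
  then have "card (switching_classes E) = 4 ^ card (E - F)"
    by (rule card_classes_private_edges[OF assms(1) F])
  then show "real (card (switching_classes E)) = 4 powi (int m - int n + int c)"
    unfolding rank power_int_of_nat by simp
qed

end
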